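(* ($N=5$.) Let $Z_{AB}=-Z_{BA}$, $A,B=1,\dots,5$, be complex variables, and for $\xi=(\xi^C)\in\mathbb C^5$ let $$\delta Z_{AB}=\tfrac12\,\xi^C\epsilon_{CABPQ}\,\bar Z^{PQ}.$$ Put $A_A{}^B=Z_{AC}\bar Z^{CB}$. Then $$S^2=\tfrac14\left[4\,\mathrm{Tr}(A^2)-(\mathrm{Tr}A)^2\right]$$ satisfies $\delta (S^2)=0$ for all $\xi$, and a linear combination $a\,(\mathrm{Tr}A)^2+b\,\mathrm{Tr}(A^2)$ with constant $a,b$ is invariant under all these transformations only if it is a constant multiple of $S^2$.
   Context: In $D=4$, $N=5$ supergravity the scalar manifold is $SU(5,1)/U(5)$ and $Z_{AB}$ are the central charges. The displayed $\delta$ are the infinitesimal transformations of $SU(5,1)$ in the coset directions; $(\mathrm{Tr}A)^2$ and $\mathrm{Tr}(A^2)$ are the $U(5)$-invariant quartics in $Z$. $\bar Z^{AB}=(Z_{AB})^*$, $\mathrm{Tr}A=Z_{AB}\bar Z^{BA}$, $\mathrm{Tr}(A^2)=Z_{AB}\bar Z^{BC}Z_{CD}\bar Z^{DA}$; $\epsilon$ is the totally antisymmetric symbol with $\epsilon_{12345}=1$; repeated indices are summed over $1,\dots,5$; $\delta$ acts as a derivation commuting with complex conjugation. *)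

theory Defs
  imports "HOL-Analysis.Analysis"
begin

text \<open>
  The index set \<open>{1,\<dots>,5}\<close> is the numeral type \<open>5\<close>. Its arithmetic is modulo 5, so the
  index 5 is written \<open>0\<close> after normalisation; the indices 1, 2, 3, 4, 5 are distinct
  and exhaust the type.
\<close>

lemma UNIV_5: "(UNIV :: 5 set) = {1, 2, 3, 4, 5}"
proof -
  have "card {1, 2, 3, 4, 5 :: 5} = CARD(5)"
    by simp
  then show ?thesis
    by (metis card_subset_eq finite subset_UNIV)
qed

definition eps :: "5 \<Rightarrow> 5 \<Rightarrow> 5 \<Rightarrow> 5 \<Rightarrow> 5 \<Rightarrow> complex" where
  "eps A B C D E =
     (let p = (\<lambda>i::5. if i = 1 then A else if i = 2 then B else if i = 3 then C
                     else if i = 4 then D else E)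
      in if bij p then of_int (sign p) else 0)"

definition antisymmetric :: "complex^5^5 \<Rightarrow> bool" where
  "antisymmetric Z \<longleftrightarrow> (\<forall>A B. Z $ A $ B = - Z $ B $ A)"

definition Zbar :: "complex^5^5 \<Rightarrow> complex^5^5" where
  "Zbar Z = (\<chi> A B. cnj (Z $ A $ B))"

definition Amat :: "complex^5^5 \<Rightarrow> complex^5^5" where
  "Amat Z = Z ** Zbar Z"

definition S2 :: "complex^5^5 \<Rightarrow> complex" where
  "S2 Z = 1/4 * (4 * trace (Amat Z ** Amat Z) - (trace (Amat Z))\<^sup>2)"

definition deltaZ :: "complex^5 \<Rightarrow> complex^5^5 \<Rightarrow> complex^5^5" where
  "deltaZ \<xi> Z = (\<chi> A B. 1/2 * (\<Sum>C\<in>UNIV. \<Sum>P\<in>UNIV. \<Sum>Q\<in>UNIV.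
     \<xi> $ C * eps C A B P Q * Zbar Z $ P $ Q))"

text \<open>
  The infinitesimal transformation acts on a function of \<open>Z\<close> and its complex conjugate as the
  derivative along the vector field \<^const>\<open>deltaZ\<close>. The parameter \<open>t\<close> is real, since the
  functions are not holomorphic in \<open>Z\<close>; polynomials in \<open>Z\<close> and its conjugate are smooth, so
  the derivative exists for them. The lemmas \<open>delta_*\<close> below show that this is the
  derivation commuting with conjugation that is determined by its values on the coordinates.
\<close>

definition delta :: "complex^5 \<Rightarrow> (complex^5^5 \<Rightarrow> complex) \<Rightarrow> complex^5^5 \<Rightarrow> complex" where
  "delta \<xi> F Z = vector_derivative (\<lambda>t::real. F (Z + t *\<^sub>R deltaZ \<xi> Z)) (at 0)"

lemma eps_12345: "eps 1 2 3 4 5 = 1"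
proof -
  have "(\<lambda>i::5. if i = 1 then 1 else if i = 2 then 2 else if i = 3 then 3
                     else if i = 4 then 4 else 5) = id"
  proof
    fix i :: 5
    have "i \<in> {1, 2, 3, 4, 5}"
      using UNIV_5 by blast
    then show "(if i = 1 then 1 else if i = 2 then 2 else if i = 3 then 3
                     else if i = 4 then 4 else 5) = id i"
      by auto
  qed
  then show ?thesis
    by (simp add: eps_def sign_id)
qed

lemma sign_symbol_swap:
  fixes p :: "5 \<Rightarrow> 5"
  assumes "i \<noteq> j" and q: "q = p \<circ> Transposition.transpose i j"
  shows "(if bij q then of_int (sign q) else 0 :: complex)
       = - (if bij p then of_int (sign p) else 0)"
proof -
  have perm: "permutation p" if "bij p"
    using that by (simp add: permutation)
  have "bij (p \<circ> Transposition.transpose i j) \<longleftrightarrow> bij p"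
    by (metis bij_swap_iff)
  then show ?thesis
    using assms(1) perm
    by (auto simp: q sign_compose permutation_swap_id sign_swap_id)
qed

lemma eps_antisym:
  "eps B A C D E = - eps A B C D E"
  "eps A C B D E = - eps A B C D E"
  "eps A B D C E = - eps A B C D E"
  "eps A B C E D = - eps A B C D E"
proof -
  let ?p = "\<lambda>A B C D E. \<lambda>i::5. if i = 1 then A else if i = 2 then B else if i = 3 then C
                     else if i = 4 then D else (E::5)"
  have ne: "(1::5) \<noteq> 2" "(2::5) \<noteq> 3" "(3::5) \<noteq> 4" "(4::5) \<noteq> 5"
    by simp_all
  have eqI: "f = g" if "f 1 = g 1" "f 2 = g 2" "f 3 = g 3" "f 4 = g 4" "f 5 = g 5"
    for f g :: "5 \<Rightarrow> 5"
  proof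
    fix i :: 5
    have "i \<in> {1, 2, 3, 4, 5}"
      using UNIV_5 by blast
    then show "f i = g i"
      using that by auto
  qed
  have "?p B A C D E = ?p A B C D E \<circ> Transposition.transpose 1 2"
    by (rule eqI) (simp_all add: Transposition.transpose_def)
  then show "eps B A C D E = - eps A B C D E"
    unfolding eps_def Let_def by (rule sign_symbol_swap[OF ne(1)])
  have "?p A C B D E = ?p A B C D E \<circ> Transposition.transpose 2 3"
    by (rule eqI) (simp_all add: Transposition.transpose_def)
  then show "eps A C B D E = - eps A B C D E"
    unfolding eps_def Let_def by (rule sign_symbol_swap[OF ne(2)])
  have "?p A B D C E = ?p A B C D E \<circ> Transposition.transpose 3 4"
    by (rule eqI) (simp_all add: Transposition.transpose_def)
  then show "eps A B D C E = - eps A B C D E"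
    unfolding eps_def Let_def by (rule sign_symbol_swap[OF ne(3)])
  have "?p A B C E D = ?p A B C D E \<circ> Transposition.transpose 4 5"
    by (rule eqI) (simp_all add: Transposition.transpose_def)
  then show "eps A B C E D = - eps A B C D E"
    unfolding eps_def Let_def by (rule sign_symbol_swap[OF ne(4)])
qed

lemma antisymmetric_deltaZ: "antisymmetric (deltaZ \<xi> Z)"
proof -
  have "deltaZ \<xi> Z $ A $ B = - deltaZ \<xi> Z $ B $ A" for A B
  proof -
    have "\<xi> $ C * eps C A B P Q * Zbar Z $ P $ Q = - (\<xi> $ C * eps C B A P Q * Zbar Z $ P $ Q)"
      for C P Q
      by (subst eps_antisym(2)) simp
    then show ?thesis
      unfolding deltaZ_def by (simp only: vec_lambda_beta sum_negf mult_minus_right)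
  qed
  then show ?thesis
    unfolding antisymmetric_def by blast
qed

lemma delta_coordinate: "delta \<xi> (\<lambda>Z. Z $ A $ B) Z = deltaZ \<xi> Z $ A $ B"
  unfolding delta_def
  by (rule vector_derivative_at) (auto intro!: derivative_eq_intros simp: vector_add_component)

lemma delta_add:
  assumes "(\<lambda>t. F (Z + t *\<^sub>R deltaZ \<xi> Z)) differentiable at (0::real)"
    and "(\<lambda>t. G (Z + t *\<^sub>R deltaZ \<xi> Z)) differentiable at (0::real)"
  shows "delta \<xi> (\<lambda>Z. F Z + G Z) Z = delta \<xi> F Z + delta \<xi> G Z"
  using assms unfolding delta_def by (rule vector_derivative_add_at)

lemma delta_const: "delta \<xi> (\<lambda>Z. c) Z = 0"
  unfolding delta_def by simp

lemma delta_mult: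
  assumes "(\<lambda>t. F (Z + t *\<^sub>R deltaZ \<xi> Z)) differentiable at (0::real)"
    and "(\<lambda>t. G (Z + t *\<^sub>R deltaZ \<xi> Z)) differentiable at (0::real)"
  shows "delta \<xi> (\<lambda>Z. F Z * G Z) Z = F Z * delta \<xi> G Z + delta \<xi> F Z * G Z"
  using vector_derivative_mult_at[OF assms] unfolding delta_def by simp

lemma delta_cnj:
  assumes "(\<lambda>t. F (Z + t *\<^sub>R deltaZ \<xi> Z)) differentiable at (0::real)"
  shows "delta \<xi> (\<lambda>Z. cnj (F Z)) Z = cnj (delta \<xi> F Z)"
  using assms unfolding delta_def
  by (intro vector_derivative_at has_vector_derivative_cnj)
     (simp add: vector_derivative_works)

end

theory Submission
  imports Defs
begin

text \<open>
  Write \<open>W\<close> for the conjugate of \<open>Z\<close>, \<open>D = \<delta>Z\<close> and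
  \<open>p\<^sub>C = \<epsilon>\<^sub>C\<^sub>A\<^sub>B\<^sub>P\<^sub>Q W\<^sub>A\<^sub>B W\<^sub>P\<^sub>Q\<close>. Up to normalisation \<open>W D = (p\<cdot>\<xi>) 1 - \<xi> p\<^sup>T\<close>, and
  \<open>p\<^sup>T W = 0\<close>, which gives \<open>4 W D W = Tr(W D) W\<close>. Multiplying by \<open>Z\<close>, taking the trace
  and adding the complex conjugate yields \<open>\<delta> Tr(A\<^sup>2) = 1/2 Tr A \<delta>(Tr A)\<close>, so that
  \<open>\<delta>(a (Tr A)\<^sup>2 + b Tr(A\<^sup>2)) = (2 a + b/2) Tr A \<delta>(Tr A)\<close>. This vanishes for all \<open>Z\<close> and \<open>\<xi>\<close>
  exactly if \<open>b = -4 a\<close>, as \<open>Tr A \<delta>(Tr A)\<close> is not identically zero.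
\<close>

section \<open>The Levi-Civita symbol and sums over the indices 0 to 4\<close>

lemma less_5: "(0::5) < 1" "(0::5) < 2" "(0::5) < 3" "(0::5) < 4" "(1::5) < 2" "(1::5) < 3"
  "(1::5) < 4" "(2::5) < 3" "(2::5) < 4" "(3::5) < 4"
  by (simp_all add: less_bit1_def bit1.Rep_0 bit1.Rep_1 bit1.Rep_numeral)

text \<open>The hypothesis only orients the rule, so that rewriting sorts the arguments.\<close>

lemma eps_swap:
  fixes A B :: 5
  assumes "A < B"
  shows "eps B A C D E = - eps A B C D E"
    and "eps C B A D E = - eps C A B D E"
    and "eps C D B A E = - eps C D A B E"
    and "eps C D E B A = - eps C D E A B"
  by (rule eps_antisym)+

text \<open>Instantiating at the ten increasing pairs of residues gives unconditional rewrite rules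
  that swap adjacent arguments only when they are out of order, so the rewriting terminates.\<close>

lemmas eps_sort = less_5[THEN eps_swap(1)] less_5[THEN eps_swap(2)]
  less_5[THEN eps_swap(3)] less_5[THEN eps_swap(4)]

text \<open>The index 5 is 0; moving it from the last place to the first takes four transpositions,
  so the sign stays +1.\<close>

lemma eps_01234: "eps 0 1 2 3 4 = 1"
proof -
  have "eps 1 2 3 4 0 = 1"
  proof -
    have "(5::5) = 0" by simp
    with eps_12345 show ?thesis by (simp only:)
  qed
  then show ?thesis
    by (simp add: eps_sort)
qed

lemma eq_minus_self_imp_zero: "x = 0" if "x = - x" for x :: complex
proof -
  have "2 * x = 0"
    using that unfolding eq_neg_iff_add_eq_0 mult_2 .
  then show ?thesis by simp
qed

lemma eps_repeated:
  "eps A A C D E = 0" "eps C A A D E = 0" "eps C D A A E = 0" "eps C D E A A = 0"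
  by (rule eq_minus_self_imp_zero, rule eps_antisym)+

lemma UNIV_5_from_0: "(UNIV :: 5 set) = {0, 1, 2, 3, 4}"
proof -
  have "(5::5) = 0" by simp
  then show ?thesis
    by (simp only: UNIV_5 insert_commute)
qed

lemma sum_5: "sum f (UNIV :: 5 set) = f 0 + f 1 + f 2 + f 3 + f 4"
  for f :: "5 \<Rightarrow> 'a::comm_monoid_add"
  unfolding UNIV_5_from_0 by (simp add: add.assoc)

lemma forall_5: "(\<forall>i::5. P i) \<longleftrightarrow> P 0 \<and> P 1 \<and> P 2 \<and> P 3 \<and> P 4"
proof -
  have "(\<forall>i::5. P i) \<longleftrightarrow> (\<forall>i\<in>UNIV. P i)" by simp
  then show ?thesis
    unfolding UNIV_5_from_0 by simp
qed

section \<open>Antisymmetric matrices in coordinates and the key cubic identity\<close>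

lemma antisymmetric_Zbar:
  assumes "antisymmetric Z"
  shows "antisymmetric (Zbar Z)"
proof -
  have "cnj (Z $ A $ B) = - cnj (Z $ B $ A)" for A B
  proof -
    have "Z $ A $ B = - Z $ B $ A"
      using assms unfolding antisymmetric_def by blast
    then show ?thesis
      unfolding complex_cnj_minus[symmetric] by (rule arg_cong)
  qed
  then show ?thesis
    unfolding antisymmetric_def Zbar_def vec_lambda_beta by blast
qed

lemma antisymmetric_nth:
  assumes "antisymmetric M"
  shows "M $ 0 $ 0 = 0" "M $ 1 $ 1 = 0" "M $ 2 $ 2 = 0" "M $ 3 $ 3 = 0" "M $ 4 $ 4 = 0"
    and "M $ 1 $ 0 = - M $ 0 $ 1" "M $ 2 $ 0 = - M $ 0 $ 2" "M $ 3 $ 0 = - M $ 0 $ 3"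
      "M $ 4 $ 0 = - M $ 0 $ 4" "M $ 2 $ 1 = - M $ 1 $ 2" "M $ 3 $ 1 = - M $ 1 $ 3"
      "M $ 4 $ 1 = - M $ 1 $ 4" "M $ 3 $ 2 = - M $ 2 $ 3" "M $ 4 $ 2 = - M $ 2 $ 4"
      "M $ 4 $ 3 = - M $ 3 $ 4"
proof -
  have *: "M $ A $ B = - M $ B $ A" for A B
    using assms unfolding antisymmetric_def by blast
  have **: "M $ A $ A = 0" for A
    using *[of A A] by (rule eq_minus_self_imp_zero)
  show "M $ 0 $ 0 = 0" "M $ 1 $ 1 = 0" "M $ 2 $ 2 = 0" "M $ 3 $ 3 = 0" "M $ 4 $ 4 = 0"
    by (rule **)+
  show "M $ 1 $ 0 = - M $ 0 $ 1" "M $ 2 $ 0 = - M $ 0 $ 2" "M $ 3 $ 0 = - M $ 0 $ 3"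
      "M $ 4 $ 0 = - M $ 0 $ 4" "M $ 2 $ 1 = - M $ 1 $ 2" "M $ 3 $ 1 = - M $ 1 $ 3"
      "M $ 4 $ 1 = - M $ 1 $ 4" "M $ 3 $ 2 = - M $ 2 $ 3" "M $ 4 $ 2 = - M $ 2 $ 4"
      "M $ 4 $ 3 = - M $ 3 $ 4"
    by (rule *)+
qed

text \<open>Each pair \<open>P\<close>, \<open>Q\<close> occurs in both orders with equal
  contributions, which cancels the factor 1/2. One signed term remains for each of the three values
  of \<open>C\<close> outside the pair \<open>A\<close>, \<open>B\<close>. By antisymmetry the ten
  entries above the diagonal suffice.\<close>

lemma deltaZ_nth:
  fixes \<xi> Z
  assumes "antisymmetric Z"
  defines "W \<equiv> Zbar Z"
  shows "deltaZ \<xi> Z $ 0 $ 1 = \<xi> $ 2 * W $ 3 $ 4 - \<xi> $ 3 * W $ 2 $ 4 + \<xi> $ 4 * W $ 2 $ 3"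
    "deltaZ \<xi> Z $ 0 $ 2 = - \<xi> $ 1 * W $ 3 $ 4 + \<xi> $ 3 * W $ 1 $ 4 - \<xi> $ 4 * W $ 1 $ 3"
    "deltaZ \<xi> Z $ 0 $ 3 = \<xi> $ 1 * W $ 2 $ 4 - \<xi> $ 2 * W $ 1 $ 4 + \<xi> $ 4 * W $ 1 $ 2"
    "deltaZ \<xi> Z $ 0 $ 4 = - \<xi> $ 1 * W $ 2 $ 3 + \<xi> $ 2 * W $ 1 $ 3 - \<xi> $ 3 * W $ 1 $ 2"
    "deltaZ \<xi> Z $ 1 $ 2 = \<xi> $ 0 * W $ 3 $ 4 - \<xi> $ 3 * W $ 0 $ 4 + \<xi> $ 4 * W $ 0 $ 3"
    "deltaZ \<xi> Z $ 1 $ 3 = - \<xi> $ 0 * W $ 2 $ 4 + \<xi> $ 2 * W $ 0 $ 4 - \<xi> $ 4 * W $ 0 $ 2"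
    "deltaZ \<xi> Z $ 1 $ 4 = \<xi> $ 0 * W $ 2 $ 3 - \<xi> $ 2 * W $ 0 $ 3 + \<xi> $ 3 * W $ 0 $ 2"
    "deltaZ \<xi> Z $ 2 $ 3 = \<xi> $ 0 * W $ 1 $ 4 - \<xi> $ 1 * W $ 0 $ 4 + \<xi> $ 4 * W $ 0 $ 1"
    "deltaZ \<xi> Z $ 2 $ 4 = - \<xi> $ 0 * W $ 1 $ 3 + \<xi> $ 1 * W $ 0 $ 3 - \<xi> $ 3 * W $ 0 $ 1"
    "deltaZ \<xi> Z $ 3 $ 4 = \<xi> $ 0 * W $ 1 $ 2 - \<xi> $ 1 * W $ 0 $ 2 + \<xi> $ 2 * W $ 0 $ 1"
  unfolding deltaZ_def W_def[symmetric] vec_lambda_beta sum_5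
  by (simp_all add: eps_sort eps_repeated eps_01234
      antisymmetric_nth[OF antisymmetric_Zbar[OF assms(1)], folded W_def])

text \<open>The factor 4 is 5 - 1: in the trace of \<open>W ** D\<close> the identity term counts
  five times and the rank-one term removes one. The proof checks all 25 entries as polynomial
  identities in \<xi> and the ten independent entries of \<open>W\<close>.\<close>

lemma Zbar_deltaZ_Zbar_nth:
  fixes \<xi> Z
  assumes "antisymmetric Z"
  defines "W \<equiv> Zbar Z" and "D \<equiv> deltaZ \<xi> Z"
  shows "4 * (W ** D ** W) $ A $ B = trace (W ** D) * W $ A $ B"
proof -
  have "\<forall>A B. 4 * (W ** D ** W) $ A $ B = trace (W ** D) * W $ A $ B"
    unfolding forall_5 trace_def matrix_matrix_mult_def vec_lambda_beta sum_5
    by (simp add: antisymmetric_nth[OF antisymmetric_Zbar[OF assms(1)], folded W_def]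
      antisymmetric_nth[OF antisymmetric_deltaZ, of \<xi> Z, folded D_def]
      deltaZ_nth[OF assms(1), folded W_def, of \<xi>, folded D_def] algebra_simps)
  then show ?thesis by blast
qed

section \<open>Derivatives of the matrix \<open>Amat Z\<close> and of its traces\<close>

lemma bounded_bilinear_matrix_matrix_mult:
  "bounded_bilinear ((**) :: complex^'n^'m \<Rightarrow> complex^'k^'n \<Rightarrow> complex^'k^'m)"
  unfolding bilinear_conv_bounded_bilinear[symmetric] bilinear_def
  by (auto intro!: linearI simp: matrix_matrix_mult_def vec_eq_iff sum.distrib algebra_simps
      scaleR_sum_right)

lemma bounded_linear_trace: "bounded_linear (trace :: complex^'n^'n \<Rightarrow> complex)"
  unfolding linear_conv_bounded_linear[symmetric]
  by (auto intro!: linearI simp: trace_def sum.distrib scaleR_sum_right)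

lemma Zbar_add: "Zbar (X + Y) = Zbar X + Zbar Y"
  by (simp add: Zbar_def vec_eq_iff)

lemma Zbar_scaleR: "Zbar (t *\<^sub>R X) = t *\<^sub>R Zbar X"
  by (simp add: Zbar_def vec_eq_iff)

lemma Zbar_mult: "Zbar (X ** Y) = Zbar X ** Zbar Y"
  by (simp add: Zbar_def vec_eq_iff matrix_matrix_mult_def)

lemma Zbar_Zbar: "Zbar (Zbar X) = X"
  by (simp add: Zbar_def vec_eq_iff)

lemma trace_Zbar: "trace (Zbar X) = cnj (trace X)"
  by (simp add: Zbar_def trace_def)

text \<open>\<open>Zbar\<close> is linear over the reals, so it maps the line through
  \<open>Z\<close> with direction \<open>D\<close> to the line through \<open>Zbar Z\<close> with
  direction \<open>Zbar D\<close>; the product rule applies.\<close>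

lemma Amat_has_vector_derivative:
  "((\<lambda>t. Amat (Z + t *\<^sub>R D)) has_vector_derivative (Z ** Zbar D + D ** Zbar Z)) (at 0)"
proof -
  have line: "((\<lambda>t. X + t *\<^sub>R Y) has_vector_derivative Y) (at 0)" for X Y :: "complex^5^5"
    by (auto intro!: derivative_eq_intros)
  show ?thesis
    using bounded_bilinear.has_vector_derivative[OF bounded_bilinear_matrix_matrix_mult line line,
        of Z D "Zbar Z" "Zbar D"]
    by (simp add: Amat_def Zbar_add Zbar_scaleR)
qed

lemma trace_square_derivative:
  assumes key: "\<And>A B. 4 * (Zbar Z ** D ** Zbar Z) $ A $ B = trace (Zbar Z ** D) * Zbar Z $ A $ B"
  defines "dA \<equiv> Z ** Zbar D + D ** Zbar Z"
  shows "2 * trace (Amat Z ** dA + dA ** Amat Z) = trace (Amat Z) * trace dA"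
proof -
  define W where "W = Zbar Z"
  define x where "x = trace (Z ** (W ** D ** W))"
  define y where "y = trace (W ** D)"
  have Wbar: "Zbar W = Z"
    by (simp add: W_def Zbar_Zbar)
  have trace_mult: "trace (Z ** M) = (\<Sum>A\<in>UNIV. \<Sum>B\<in>UNIV. Z $ A $ B * M $ B $ A)" for M
    by (simp add: trace_def matrix_matrix_mult_def)
  \<comment> \<open>Contraction of the cubic identity with \<open>Z\<close>.\<close>
  have x: "4 * x = y * trace (Z ** W)"
  proof -
    have "4 * x = (\<Sum>A\<in>UNIV. \<Sum>B\<in>UNIV. Z $ A $ B * (4 * (W ** D ** W) $ B $ A))"
      unfolding x_def trace_mult by (simp only: sum_distrib_left mult.left_commute[of 4])
    also have "\<dots> = y * trace (Z ** W)"
      unfolding key[folded W_def] y_def trace_mult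
      by (simp only: sum_distrib_left mult.left_commute)
    finally show ?thesis .
  qed
  \<comment> \<open>Conjugation turns \<open>Z ** W\<close> into \<open>W ** Z\<close>, which has
    the same trace.\<close>
  have real: "cnj (trace (Z ** W)) = trace (Z ** W)"
    unfolding trace_Zbar[symmetric] Zbar_mult Wbar W_def[symmetric] by (rule trace_mul_sym)
  have cx: "4 * cnj x = cnj y * trace (Z ** W)"
    using arg_cong[OF x, of cnj] by (simp add: real)
  have "trace (Z ** W ** (D ** W)) = x"
    by (simp add: x_def matrix_mul_assoc)
  \<comment> \<open>Cyclicity rewrites \<open>x\<close> as the trace of
    \<open>W ** Z ** (W ** D)\<close>, and conjugation interchanges \<open>Z\<close> with
    \<open>W\<close> and \<open>D\<close> with \<open>Zbar D\<close>.\<close>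
  moreover have "trace (Z ** W ** (Z ** Zbar D)) = cnj x"
  proof -
    have "x = trace (W ** Z ** (W ** D))"
      unfolding x_def using trace_mul_sym[of Z "W ** D ** W"] trace_mul_sym[of "W ** D" "W ** Z"]
      by (simp add: matrix_mul_assoc)
    then show ?thesis
      by (simp add: Zbar_mult Wbar flip: trace_Zbar W_def)
  qed
  ultimately have "trace (Amat Z ** dA) = x + cnj x"
    by (simp add: Amat_def dA_def matrix_add_ldistrib trace_add flip: W_def)
  then have "trace (Amat Z ** dA + dA ** Amat Z) = 2 * (x + cnj x)"
    by (simp add: trace_add trace_mul_sym[of dA])
  moreover have "trace dA = y + cnj y"
  proof -
    have "trace (Z ** Zbar D) = cnj y"
      by (simp add: y_def Zbar_mult Wbar flip: trace_Zbar)
    then show ?thesis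
      by (simp add: dA_def y_def trace_add trace_mul_sym[of D] flip: W_def)
  qed
  moreover have "2 * (2 * (x + cnj x)) = trace (Z ** W) * (y + cnj y)"
    using x cx by (simp add: distrib_left mult.commute)
  ultimately show ?thesis
    by (simp only: Amat_def flip: W_def)
qed

lemma delta_quartic:
  fixes \<xi> Z
  assumes "antisymmetric Z"
  defines "dA \<equiv> Z ** Zbar (deltaZ \<xi> Z) + deltaZ \<xi> Z ** Zbar Z"
  shows "delta \<xi> (\<lambda>Z. a * (trace (Amat Z))\<^sup>2 + b * trace (Amat Z ** Amat Z)) Z
    = (2 * a + b / 2) * (trace (Amat Z) * trace dA)"
proof -
  define A where "A = (\<lambda>t. Amat (Z + t *\<^sub>R deltaZ \<xi> Z))"
  have A0: "A 0 = Amat Z"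
    by (simp add: A_def)
  have A: "(A has_vector_derivative dA) (at 0)"
    unfolding A_def dA_def by (rule Amat_has_vector_derivative)
  have T: "((\<lambda>t. trace (A t)) has_vector_derivative trace dA) (at 0)"
    by (rule bounded_linear.has_vector_derivative[OF bounded_linear_trace A])
  have Q: "((\<lambda>t. trace (A t ** A t)) has_vector_derivative
      trace (Amat Z ** dA + dA ** Amat Z)) (at 0)"
    using bounded_linear.has_vector_derivative[OF bounded_linear_trace
        bounded_bilinear.has_vector_derivative[OF bounded_bilinear_matrix_matrix_mult A A]]
    by (simp only: A0)
  have T2: "((\<lambda>t. (trace (A t))\<^sup>2) has_vector_derivative 2 * (trace (Amat Z) * trace dA)) (at 0)"
    using has_vector_derivative_mult[OF T T] by (simp add: power2_eq_square A0 mult.commute)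
  have "delta \<xi> (\<lambda>Z. a * (trace (Amat Z))\<^sup>2 + b * trace (Amat Z ** Amat Z)) Z
      = a * (2 * (trace (Amat Z) * trace dA)) + b * trace (Amat Z ** dA + dA ** Amat Z)"
    using has_vector_derivative_add[OF has_vector_derivative_mult_right[OF T2, of a]
        has_vector_derivative_mult_right[OF Q, of b]]
    unfolding delta_def A_def by (rule vector_derivative_at)
  moreover have "trace (Amat Z ** dA + dA ** Amat Z) = trace (Amat Z) * trace dA / 2"
    using trace_square_derivative[OF Zbar_deltaZ_Zbar_nth[OF assms(1)], of \<xi>, folded dA_def]
    by (simp add: eq_divide_eq mult.commute)
  ultimately show ?thesis
    by (simp add: algebra_simps)
qed

lemma delta_quartic_nonzero:
  obtains \<xi> Z where "antisymmetric Z" "trace (Amat Z) \<noteq> 0"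
    "trace (Z ** Zbar (deltaZ \<xi> Z) + deltaZ \<xi> Z ** Zbar Z) \<noteq> 0"
proof -
  \<comment> \<open>For this \<xi> the transformation sends the conjugate of the (3,4) entry to the
    (1,2) entry and vice versa. Setting both to 1 and the other independent entries to 0 gives a
    real \<open>Z\<close> with \<open>deltaZ \<xi> Z = Z\<close>, so the two traces are -4 and
    -8.\<close>
  define \<xi> :: "complex^5" where "\<xi> = (\<chi> C. if C = 0 then 1 else 0)"
  define Z :: "complex^5^5" where
    "Z = (\<chi> A B. if A = 1 \<and> B = 2 \<or> A = 3 \<and> B = 4 then 1
      else if A = 2 \<and> B = 1 \<or> A = 4 \<and> B = 3 then -1 else 0)"
  have Z: "antisymmetric Z"
    unfolding antisymmetric_def forall_5 by (simp add: Z_def)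
  have Zbar: "Zbar Z = Z"
    by (simp add: Zbar_def Z_def vec_eq_iff)
  have "\<forall>A B. deltaZ \<xi> Z $ A $ B = Z $ A $ B"
    unfolding forall_5
    by (simp add: antisymmetric_nth[OF antisymmetric_deltaZ] deltaZ_nth[OF Z] Zbar)
      (simp add: Z_def \<xi>_def)
  then have D: "deltaZ \<xi> Z = Z"
    by (simp add: vec_eq_iff)
  have T: "trace (Z ** Z) = -4"
    unfolding trace_def matrix_matrix_mult_def vec_lambda_beta sum_5 by (simp add: Z_def)
  show thesis
    by (rule that[OF Z, of \<xi>]) (simp_all only: Amat_def Zbar D T trace_add, simp_all)
qed

theorem mainTheorem5:
  shows "(\<forall>\<xi> Z. antisymmetric Z \<longrightarrow> delta \<xi> S2 Z = 0) \<and>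
    (\<forall>a b :: complex.
       (\<forall>\<xi> Z. antisymmetric Z \<longrightarrow>
          delta \<xi> (\<lambda>Z. a * (trace (Amat Z))\<^sup>2 + b * trace (Amat Z ** Amat Z)) Z = 0) \<longrightarrow>
       (\<exists>c :: complex. \<forall>Z. antisymmetric Z \<longrightarrow>
          a * (trace (Amat Z))\<^sup>2 + b * trace (Amat Z ** Amat Z) = c * S2 Z))"
proof (intro conjI allI impI)
  fix \<xi> Z
  assume "antisymmetric Z"
  \<comment> \<open>With a = -1/4 and b = 1 the coefficient 2 a + b/2 vanishes.\<close>
  have "S2 = (\<lambda>Z. (-1/4) * (trace (Amat Z))\<^sup>2 + 1 * trace (Amat Z ** Amat Z))"
    by (simp add: S2_def fun_eq_iff algebra_simps)
  then show "delta \<xi> S2 Z = 0"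
    using delta_quartic[OF \<open>antisymmetric Z\<close>, of \<xi> "-1/4" 1] by simp
next
  fix a b :: complex
  assume invariant: "\<forall>\<xi> Z. antisymmetric Z \<longrightarrow>
    delta \<xi> (\<lambda>Z. a * (trace (Amat Z))\<^sup>2 + b * trace (Amat Z ** Amat Z)) Z = 0"
  obtain \<xi> Z where Z: "antisymmetric Z" and nonzero: "trace (Amat Z) \<noteq> 0"
    "trace (Z ** Zbar (deltaZ \<xi> Z) + deltaZ \<xi> Z ** Zbar Z) \<noteq> 0"
    by (rule delta_quartic_nonzero)
  have "(2 * a + b / 2) *
      (trace (Amat Z) * trace (Z ** Zbar (deltaZ \<xi> Z) + deltaZ \<xi> Z ** Zbar Z)) = 0"
    unfolding delta_quartic[OF Z, symmetric] using invariant Z by blast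
  then have "2 * a + b / 2 = 0"
    using nonzero by simp
  then have "2 * (2 * a + b / 2) = 0"
    by (simp only: mult_zero_right)
  then have "b = - (4 * a)"
    by (simp add: eq_neg_iff_add_eq_0 algebra_simps)
  \<comment> \<open>The multiple is \<open>b\<close>, because \<open>S2\<close> has coefficient 1 at
    the trace of the square.\<close>
  then have "a * (trace (Amat Z))\<^sup>2 + b * trace (Amat Z ** Amat Z) = b * S2 Z" for Z
    by (simp add: S2_def algebra_simps)
  then show "\<exists>c. \<forall>Z. antisymmetric Z \<longrightarrow>
      a * (trace (Amat Z))\<^sup>2 + b * trace (Amat Z ** Amat Z) = c * S2 Z"
    by blast
qed

end
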